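(* Let the function $\psi_1\in\mathcal T_1$ have the integral representation $$\psi_1(s)=c_0+\int_0^\infty(e^{su}-1)\,d\mu_1(u),$$ with $\omega:=\int_0^\infty u\,d\mu_1(u)\neq\infty$. Then the function $$\psi(s_1,s_2):=\frac{\psi_1(s_1)-\psi_1(s_2)}{s_1-s_2}-\omega$$ belongs to $\mathcal T_2$ and has the integral representation $$\psi(s_1,s_2)=\int_0^\infty\int_0^\infty\left(e^{s_1u_1+s_2u_2}-1\right)d\mu(u_1,u_2),$$ where $d\mu(u_1,u_2)$ is the image of the measure $d\mu_1(v)\,dw$ under the map $$u_1=\frac{v+w}{2},\qquad u_2=\frac{v-w}{2}.$$
   Context: A function in $C^\infty((-\infty,0)^n)$ is called absolutely monotone if it is nonnegative together with all its partial derivatives of all orders. $\mathcal T_n$ is the class of all nonpositive functions in $C^\infty((-\infty,0)^n)$ all of whose first-order partial derivatives are absolutely monotone. The variables $s,s_1,s_2$ range over $(-\infty,0)$; $c_0=\lim_{s\to-0}\psi_1(s)\le 0$ is a constant, $\mu_1$ is a positive Radon measure on $(0,\infty)$, and $dw$ is Lebesgue measure. The value of $\psi$ at a point with $s_1=s_2$ is understood as its limit as $s_2\to s_1$.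
   Formalization: The measure μ is taken as one half of the image of dμ₁(v)dw: without the factor 1/2 the integral equals 2ψ (e.g. μ₁=δ₁, ψ₁(s)=e^s−1 gives ψ(s,s)=e^s−1 but the stated integral is 2(e^s−1)). *)

theory Defs
  imports "HOL-Analysis.Analysis"
begin

text \<open>The negative orthant of a Euclidean space, with respect to its standard basis. It is
  \<open>(-\<infinity>,0)\<close> on \<^typ>\<open>real\<close> and \<open>(-\<infinity>,0)\<^sup>2\<close> on \<^typ>\<open>real \<times> real\<close>.\<close>

definition neg_orthant :: "'a::euclidean_space set" where
  "neg_orthant = {x. \<forall>b\<in>Basis. x \<bullet> b < 0}"

definition partial_derivative ::
    "'a::euclidean_space \<Rightarrow> ('a \<Rightarrow> real) \<Rightarrow> 'a \<Rightarrow> real" where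
  "partial_derivative b f = (\<lambda>x. deriv (\<lambda>t. f (x + t *\<^sub>R b)) 0)"

text \<open>\<open>iterated_partial [b\<^sub>1, \<dots>, b\<^sub>k] f\<close> is
  \<open>\<partial>\<^bsub>b\<^sub>1\<^esub> \<dots> \<partial>\<^bsub>b\<^sub>k\<^esub> f\<close>; the empty list gives \<open>f\<close> itself.\<close>

definition iterated_partial ::
    "'a::euclidean_space list \<Rightarrow> ('a \<Rightarrow> real) \<Rightarrow> 'a \<Rightarrow> real" where
  "iterated_partial bs f = foldr partial_derivative bs f"

text \<open>\<^const>\<open>deriv\<close> is total, so existence of every partial derivative is demanded separately.
  Only meant for open \<open>S\<close>.\<close>

definition C_infinity_on :: "'a::euclidean_space set \<Rightarrow> ('a \<Rightarrow> real) \<Rightarrow> bool" where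
  "C_infinity_on S f \<longleftrightarrow>
     (\<forall>bs. set bs \<subseteq> Basis \<longrightarrow>
        continuous_on S (iterated_partial bs f) \<and>
        (\<forall>x\<in>S. \<forall>b\<in>Basis.
           (\<lambda>t. iterated_partial bs f (x + t *\<^sub>R b)) field_differentiable (at 0)))"

definition absolutely_monotone :: "('a::euclidean_space \<Rightarrow> real) \<Rightarrow> bool" where
  "absolutely_monotone f \<longleftrightarrow>
     C_infinity_on neg_orthant f \<and>
     (\<forall>bs. set bs \<subseteq> Basis \<longrightarrow> (\<forall>x\<in>neg_orthant. 0 \<le> iterated_partial bs f x))"

text \<open>The class \<open>\<T>\<^sub>n\<close>, with \<open>n\<close> the dimension of the argument type; values outside the negative
  orthant are irrelevant.\<close>

definition class_T :: "('a::euclidean_space \<Rightarrow> real) set" where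
  "class_T = {\<psi>. C_infinity_on neg_orthant \<psi> \<and>
     (\<forall>x\<in>neg_orthant. \<psi> x \<le> 0) \<and>
     (\<forall>b\<in>Basis. absolutely_monotone (partial_derivative b \<psi>))}"

definition radon_measure_on :: "'a::topological_space set \<Rightarrow> 'a measure \<Rightarrow> bool" where
  "radon_measure_on S M \<longleftrightarrow>
     sets M = sets (restrict_space borel S) \<and>
     (\<forall>K. compact K \<and> K \<subseteq> S \<longrightarrow> emeasure M K < \<infinity>) \<and>
     (\<forall>B\<in>sets M. emeasure M B = (SUP K\<in>{K. compact K \<and> K \<subseteq> B}. emeasure M K))"

definition shifted_quotient :: "(real \<Rightarrow> real) \<Rightarrow> real \<Rightarrow> real \<Rightarrow> real \<Rightarrow> real" where
  "shifted_quotient \<psi>\<^sub>1 \<omega> s\<^sub>1 s\<^sub>2 = (\<psi>\<^sub>1 s\<^sub>1 - \<psi>\<^sub>1 s\<^sub>2) / (s\<^sub>1 - s\<^sub>2) - \<omega>"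

definition psi_of :: "(real \<Rightarrow> real) \<Rightarrow> real \<Rightarrow> real \<times> real \<Rightarrow> real" where
  "psi_of \<psi>\<^sub>1 \<omega> = (\<lambda>(s\<^sub>1, s\<^sub>2).
     if s\<^sub>1 = s\<^sub>2 then Lim (at s\<^sub>1) (shifted_quotient \<psi>\<^sub>1 \<omega> s\<^sub>1)
     else shifted_quotient \<psi>\<^sub>1 \<omega> s\<^sub>1 s\<^sub>2)"

text \<open>The plain image measure; the part of it lying outside \<open>(0,\<infinity>)\<^sup>2\<close>, that is
  \<open>\<bar>w\<bar> \<ge> v\<close>, is irrelevant for integrals over \<open>(0,\<infinity>)\<^sup>2\<close>. To represent \<open>\<psi>\<close> it has to be multiplied
  by the Jacobian factor \<open>1/2\<close>, because \<open>w = 2u - v\<close> gives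
  \[ \frac{e^{s_1 v} - e^{s_2 v}}{s_1 - s_2} = \int_0^v e^{s_1 u + s_2 (v - u)} \, du
     = \frac12 \int_{-v}^{v} e^{s_1 (v + w)/2 + s_2 (v - w)/2} \, dw. \]
  Without the factor the integral would be \<open>2\<psi>\<close>.\<close>

definition image_measure :: "real measure \<Rightarrow> (real \<times> real) measure" where
  "image_measure \<mu>\<^sub>1 =
     distr (\<mu>\<^sub>1 \<Otimes>\<^sub>M lborel) borel (\<lambda>(v, w). ((v + w) / 2, (v - w) / 2))"

end

theory Submission
  imports Defs
begin

text \<open>
  The representing measure is finite, and this is what makes the proof short. Restrict half the
  image measure to the open quadrant and call the result \<open>N\<close>. On the quadrant \<open>w\<close> runs over
  \<open>(-v, v)\<close>, an interval of length \<open>2 v\<close>, so the total mass of \<open>N\<close> is \<open>\<integral> v d\<mu>\<^sub>1(v) = \<omega>\<close>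
  (\<open>emeasure_quadrant_measure\<close>). Integrating \<open>exp (s\<^sub>1 u\<^sub>1 + s\<^sub>2 u\<^sub>2)\<close> over \<open>w\<close> first gives
  \<open>(exp (s\<^sub>1 v) - exp (s\<^sub>2 v)) / (s\<^sub>1 - s\<^sub>2)\<close> (\<open>nn_integral_exp_quadrant_measure\<close>), and the
  integral of this over \<open>\<mu>\<^sub>1\<close> is the divided difference of \<open>\<psi>\<^sub>1\<close>. Subtracting \<open>\<omega>\<close>, the mass
  of \<open>N\<close>, from the Laplace transform of \<open>N\<close> is the same as integrating
  \<open>exp (s\<^sub>1 u\<^sub>1 + s\<^sub>2 u\<^sub>2) - 1\<close>; this is the representation off the diagonal. On the diagonal both
  sides are determined by continuity.

  Membership in the class \<open>\<T>\<^sub>n\<close> holds in any dimension for \<open>x \<mapsto> \<integral> (exp (x \<bullet> u) - 1) dN(u)\<close>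
  with \<open>N\<close> finite and concentrated on the nonnegative orthant (\<open>class_T_if_integral\<close>): every
  derivative may be taken under the integral, where it produces a factor \<open>u \<bullet> b \<ge> 0\<close>.
\<close>

section \<open>Laplace transforms of finite measures on the nonnegative orthant\<close>

text \<open>Dominated convergence along the filter \<open>at x within S\<close>. Requiring the bound on all of \<open>S\<close>
  costs nothing: for an open \<open>S\<close> containing \<open>x\<close> the filter is \<open>at x\<close>, so \<open>S\<close> may be any
  neighbourhood of \<open>x\<close> on which a dominating function is known.\<close>

lemma tendsto_integral_within:
  fixes f :: "'b::first_countable_topology \<Rightarrow> 'a \<Rightarrow> real"
  assumes "\<And>y. f y \<in> borel_measurable M" "g \<in> borel_measurable M" "integrable M w"
    and bound: "AE u in M. \<forall>y\<in>S - {x}. \<bar>f y u\<bar> \<le> w u"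
    and lim: "AE u in M. ((\<lambda>y. f y u) \<longlongrightarrow> g u) (at x within S)"
  shows "((\<lambda>y. \<integral>u. f y u \<partial>M) \<longlongrightarrow> (\<integral>u. g u \<partial>M)) (at x within S)"
  unfolding tendsto_at_iff_sequentially comp_def
proof (intro allI impI)
  fix X assume X: "\<forall>i. X i \<in> S - {x}" "X \<longlonglongrightarrow> x"
  show "(\<lambda>i. \<integral>u. f (X i) u \<partial>M) \<longlonglongrightarrow> (\<integral>u. g u \<partial>M)"
  proof (rule integral_dominated_convergence[where w=w])
    show "AE u in M. (\<lambda>i. f (X i) u) \<longlonglongrightarrow> g u"
      using lim by eventually_elim (use X in \<open>auto simp: tendsto_at_iff_sequentially comp_def\<close>)
    show "\<And>i. AE u in M. norm (f (X i) u) \<le> w u"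
      using bound by eventually_elim (use X in auto)
  qed (use assms in auto)
qed

definition nonneg_orthant :: "'a::euclidean_space set" where
  "nonneg_orthant = {u. \<forall>b\<in>Basis. 0 \<le> u \<bullet> b}"

text \<open>The iterated derivative of \<open>exp (x \<bullet> u) - 1\<close> with respect to \<open>x\<close> along the directions
  \<open>bs\<close>. Including the constant in the undifferentiated case lets one formula serve the function
  and all of its derivatives.\<close>

definition kernel :: "'a::euclidean_space list \<Rightarrow> 'a \<Rightarrow> 'a \<Rightarrow> real" where
  "kernel bs x u = (\<Prod>b\<leftarrow>bs. u \<bullet> b) * exp (x \<bullet> u) - (if bs = [] then 1 else 0)"

lemma kernel_measurable: "kernel bs x \<in> borel_measurable borel"
proof -
  have "(\<lambda>u::'a. \<Prod>b\<leftarrow>bs. u \<bullet> b) \<in> borel_measurable borel"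
    by (induction bs) auto
  then show ?thesis
    unfolding kernel_def by measurable
qed

lemma moment_nonneg:
  assumes "u \<in> nonneg_orthant" "set bs \<subseteq> Basis"
  shows "0 \<le> (\<Prod>b\<leftarrow>bs. u \<bullet> b)"
  using assms(2) by (induction bs) (use assms(1) in \<open>auto simp: nonneg_orthant_def\<close>)

text \<open>The dominating constants. Each factor \<open>u \<bullet> b\<close> is absorbed by half of the exponential decay
  that is still available, which is why the induction is over all \<open>\<delta>\<close>.\<close>

lemma moment_exp_bounded:
  fixes bs :: "'a::euclidean_space list"
  assumes "set bs \<subseteq> Basis" "0 < \<delta>"
  shows "\<exists>C\<ge>0. \<forall>u\<in>nonneg_orthant. (\<Prod>b\<leftarrow>bs. u \<bullet> b) * exp (- \<delta> * (\<Sum>b\<in>Basis. u \<bullet> b)) \<le> C"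
  using assms
proof (induction bs arbitrary: \<delta>)
  case Nil
  show ?case
    by (intro exI[of _ 1]) (use Nil in \<open>auto simp: nonneg_orthant_def intro!: mult_nonneg_nonneg sum_nonneg\<close>)
next
  case (Cons b bs)
  then obtain C where C: "0 \<le> C"
    "\<And>u. u \<in> nonneg_orthant \<Longrightarrow> (\<Prod>b\<leftarrow>bs. u \<bullet> b) * exp (- (\<delta>/2) * (\<Sum>b\<in>Basis. u \<bullet> b)) \<le> C"
    using Cons.IH[of "\<delta>/2"] by auto
  show ?case
  proof (intro exI[of _ "2 / \<delta> * C"] conjI ballI)
    fix u :: 'a assume u: "u \<in> nonneg_orthant"
    define r where "r = (\<Sum>b\<in>Basis. u \<bullet> b)"
    have "u \<bullet> b \<le> r"
      unfolding r_def using u Cons.prems by (intro member_le_sum) (auto simp: nonneg_orthant_def)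
    moreover have "\<delta>/2 * r \<le> exp (\<delta>/2 * r)"
      using exp_ge_add_one_self[of "\<delta>/2 * r"] by linarith
    ultimately have "\<delta>/2 * (u \<bullet> b) \<le> exp (\<delta>/2 * r)"
      using \<open>0 < \<delta>\<close> mult_left_mono[of "u \<bullet> b" r "\<delta>/2"] by linarith
    then have "u \<bullet> b \<le> 2 / \<delta> * exp (\<delta>/2 * r)"
      using \<open>0 < \<delta>\<close> by (simp add: field_simps)
    then have 1: "(u \<bullet> b) * exp (- (\<delta>/2) * r) \<le> 2 / \<delta>"
      by (simp add: exp_minus field_simps)
    have "(\<Prod>b\<leftarrow>b # bs. u \<bullet> b) * exp (- \<delta> * r)
        = ((u \<bullet> b) * exp (- (\<delta>/2) * r)) * ((\<Prod>b\<leftarrow>bs. u \<bullet> b) * exp (- (\<delta>/2) * r))"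
      by (simp add: exp_add[symmetric] algebra_simps)
    also have "\<dots> \<le> 2 / \<delta> * C"
      using 1 C(2)[OF u] moment_nonneg[OF u, of bs] Cons.prems
      by (intro mult_mono) (auto simp: r_def)
    finally show "(\<Prod>b\<leftarrow>b # bs. u \<bullet> b) * exp (- \<delta> * (\<Sum>b\<in>Basis. u \<bullet> b)) \<le> 2 / \<delta> * C"
      by (simp add: r_def)
  qed (use C \<open>0 < \<delta>\<close> in auto)
qed

lemma inner_le_neg_sum:
  fixes x u :: "'a::euclidean_space"
  assumes "u \<in> nonneg_orthant" "\<And>b. b \<in> Basis \<Longrightarrow> x \<bullet> b < - \<delta>"
  shows "x \<bullet> u \<le> - \<delta> * (\<Sum>b\<in>Basis. u \<bullet> b)"
proof -
  have "x \<bullet> u = (\<Sum>b\<in>Basis. (x \<bullet> b) * (u \<bullet> b))"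
    by (rule euclidean_inner)
  also have "\<dots> \<le> (\<Sum>b\<in>Basis. - \<delta> * (u \<bullet> b))"
    using assms by (intro sum_mono mult_right_mono) (auto simp: nonneg_orthant_def less_imp_le)
  finally show ?thesis
    by (simp add: sum_distrib_left)
qed

lemma open_shifted_orthant: "open {x::'a::euclidean_space. \<forall>b\<in>Basis. x \<bullet> b < c}"
proof -
  have "{x::'a. \<forall>b\<in>Basis. x \<bullet> b < c} = (\<Inter>b\<in>Basis. {x. x \<bullet> b < c})"
    by auto
  then show ?thesis
    by (auto intro!: open_INT open_Collect_less continuous_intros)
qed

text \<open>No decay rate is uniform on the negative orthant, but every point has an open neighbourhood,
  a shifted orthant, with such a rate.\<close>

lemma neg_orthant_shift:
  fixes x :: "'a::euclidean_space"
  assumes "x \<in> neg_orthant"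
  obtains \<delta> where "0 < \<delta>" "x \<in> {x. \<forall>b\<in>Basis. x \<bullet> b < - \<delta>}"
proof
  define m where "m = Min ((\<lambda>b. - (x \<bullet> b)) ` Basis)"
  have m: "0 < m" unfolding m_def
    using assms by (subst Min_gr_iff) (auto simp: neg_orthant_def)
  then show "0 < m / 2" by simp
  have "m \<le> - (x \<bullet> b)" if "b \<in> Basis" for b
    unfolding m_def using that by (intro Min_le) auto
  with m show "x \<in> {x. \<forall>b\<in>Basis. x \<bullet> b < - (m / 2)}"
    by fastforce
qed

lemma abs_exp_diff_le:
  fixes a b c :: real
  assumes "a \<le> c" "b \<le> c"
  shows "\<bar>exp a - exp b\<bar> \<le> \<bar>a - b\<bar> * exp c"
proof -
  have *: "exp q - exp p \<le> (q - p) * exp c" if "p \<le> q" "q \<le> c" for p q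
  proof -
    have "exp q * (1 + (p - q)) \<le> exp q * exp (p - q)"
      by (intro mult_left_mono exp_ge_add_one_self) auto
    then have "exp q - exp p \<le> (q - p) * exp q"
      by (simp add: exp_add[symmetric] algebra_simps)
    also have "\<dots> \<le> (q - p) * exp c"
      using that by (intro mult_left_mono) auto
    finally show ?thesis .
  qed
  show ?thesis
    using *[of a b] *[of b a] assms by (cases "a \<le> b") (auto simp: abs_if)
qed

locale orthant_measure = finite_measure N for N :: "'a::euclidean_space measure" +
  assumes sets_eq: "sets N = sets borel"
    and concentrated: "AE u in N. u \<in> nonneg_orthant"
begin

lemma measurable_kernel: "kernel bs x \<in> borel_measurable N"
  using kernel_measurable measurable_cong_sets[OF sets_eq refl] by blast

lemma kernel_bounded:
  assumes "set bs \<subseteq> Basis" "0 < \<delta>"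
  shows "\<exists>C. \<forall>u\<in>nonneg_orthant. \<forall>x\<in>{x. \<forall>b\<in>Basis. x \<bullet> b < - \<delta>}. \<bar>kernel bs x u\<bar> \<le> C"
proof -
  obtain C where C: "0 \<le> C"
    "\<And>u. u \<in> nonneg_orthant \<Longrightarrow> (\<Prod>b\<leftarrow>bs. u \<bullet> b) * exp (- \<delta> * (\<Sum>b\<in>Basis. u \<bullet> b)) \<le> C"
    using moment_exp_bounded[OF assms] by blast
  have "\<bar>kernel bs x u\<bar> \<le> C + 1"
    if u: "u \<in> nonneg_orthant" and x: "x \<in> {x. \<forall>b\<in>Basis. x \<bullet> b < - \<delta>}" for x u
  proof -
    have "(\<Prod>b\<leftarrow>bs. u \<bullet> b) * exp (x \<bullet> u) \<le> (\<Prod>b\<leftarrow>bs. u \<bullet> b) * exp (- \<delta> * (\<Sum>b\<in>Basis. u \<bullet> b))"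
      using moment_nonneg[OF u assms(1)] inner_le_neg_sum[OF u, of x \<delta>] x by (intro mult_left_mono) auto
    then have "(\<Prod>b\<leftarrow>bs. u \<bullet> b) * exp (x \<bullet> u) \<le> C"
      using C(2)[OF u] by (rule order_trans)
    moreover have "0 \<le> (\<Prod>b\<leftarrow>bs. u \<bullet> b) * exp (x \<bullet> u)"
      using moment_nonneg[OF u assms(1)] by auto
    ultimately show ?thesis
      using C(1) by (cases "bs = []") (auto simp: kernel_def abs_le_iff intro: order_trans[of _ 0])
  qed
  then show ?thesis by blast
qed

lemma integrable_kernel:
  assumes "set bs \<subseteq> Basis" "x \<in> neg_orthant"
  shows "integrable N (kernel bs x)"
proof -
  obtain \<delta> where \<delta>: "0 < \<delta>" "x \<in> {x. \<forall>b\<in>Basis. x \<bullet> b < - \<delta>}"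
    using neg_orthant_shift[OF assms(2)] .
  obtain C where C: "\<And>x u. u \<in> nonneg_orthant \<Longrightarrow> x \<in> {x. \<forall>b\<in>Basis. x \<bullet> b < - \<delta>} \<Longrightarrow> \<bar>kernel bs x u\<bar> \<le> C"
    using kernel_bounded[OF assms(1) \<delta>(1)] by blast
  show ?thesis
  proof (rule integrable_const_bound)
    show "AE u in N. norm (kernel bs x u) \<le> C"
      using concentrated by eventually_elim (use C \<delta> in auto)
  qed (rule measurable_kernel)
qed

lemma continuous_on_integral_kernel:
  assumes "set bs \<subseteq> Basis"
  shows "continuous_on neg_orthant (\<lambda>x. \<integral>u. kernel bs x u \<partial>N)"
proof (rule continuous_at_imp_continuous_on, rule ballI)
  fix x :: 'a assume x: "x \<in> neg_orthant"
  obtain \<delta> where \<delta>: "0 < \<delta>" "x \<in> {x. \<forall>b\<in>Basis. x \<bullet> b < - \<delta>}"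
    using neg_orthant_shift[OF x] .
  obtain C where C: "\<And>x u. u \<in> nonneg_orthant \<Longrightarrow> x \<in> {x. \<forall>b\<in>Basis. x \<bullet> b < - \<delta>} \<Longrightarrow> \<bar>kernel bs x u\<bar> \<le> C"
    using kernel_bounded[OF assms \<delta>(1)] by blast
  have "((\<lambda>y. \<integral>u. kernel bs y u \<partial>N) \<longlongrightarrow> (\<integral>u. kernel bs x u \<partial>N)) (at x within {x. \<forall>b\<in>Basis. x \<bullet> b < - \<delta>})"
  proof (rule tendsto_integral_within)
    show "AE u in N. \<forall>y\<in>{x. \<forall>b\<in>Basis. x \<bullet> b < - \<delta>} - {x}. \<bar>kernel bs y u\<bar> \<le> C"
      using concentrated by eventually_elim (use C in auto)
    show "AE u in N. ((\<lambda>y. kernel bs y u) \<longlongrightarrow> kernel bs x u) (at x within {x. \<forall>b\<in>Basis. x \<bullet> b < - \<delta>})"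
      unfolding kernel_def by (intro AE_I2 tendsto_intros)
  qed (auto intro: measurable_kernel)
  then show "isCont (\<lambda>x. \<integral>u. kernel bs x u \<partial>N) x"
    using at_within_open[OF \<delta>(2) open_shifted_orthant] by (simp add: isCont_def)
qed

text \<open>Differentiation under the integral: by the mean value bound for \<open>exp\<close>, the difference
  quotients of the kernel for \<open>bs\<close> are dominated by the constant that bounds the kernel of \<open>b # bs\<close>.\<close>

lemma has_partial_derivative_integral_kernel:
  assumes bs: "set bs \<subseteq> Basis" and b: "b \<in> Basis" and x: "x \<in> neg_orthant"
  shows "((\<lambda>t. \<integral>u. kernel bs (x + t *\<^sub>R b) u \<partial>N) has_field_derivative
           (\<integral>u. kernel (b # bs) x u \<partial>N)) (at 0)"
proof -
  obtain \<delta> where \<delta>: "0 < \<delta>" "x \<in> {x. \<forall>b\<in>Basis. x \<bullet> b < - \<delta>}"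
    using neg_orthant_shift[OF x] .
  define S where "S = {t. x + t *\<^sub>R b \<in> {x. \<forall>b\<in>Basis. x \<bullet> b < - \<delta>}}"
  have "open ((\<lambda>t. x + t *\<^sub>R b) -` {x. \<forall>b\<in>Basis. x \<bullet> b < - \<delta>})"
    by (intro open_vimage open_shifted_orthant continuous_intros)
  then have S: "open S" "0 \<in> S"
    using \<delta> by (auto simp: S_def vimage_def)
  have "set (b # bs) \<subseteq> Basis" using bs b by simp
  then obtain C where C: "0 \<le> C"
    "\<And>u. u \<in> nonneg_orthant \<Longrightarrow> (\<Prod>b\<leftarrow>b # bs. u \<bullet> b) * exp (- \<delta> * (\<Sum>b\<in>Basis. u \<bullet> b)) \<le> C"
    using moment_exp_bounded[OF _ \<delta>(1)] by blast
  define q where "q t u = (kernel bs (x + t *\<^sub>R b) u - kernel bs x u) / t" for t u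
  have q_le: "\<bar>q t u\<bar> \<le> C" if u: "u \<in> nonneg_orthant" and t: "t \<in> S - {0}" for t u
  proof -
    let ?P = "\<Prod>b\<leftarrow>bs. u \<bullet> b" and ?E = "exp (- \<delta> * (\<Sum>b\<in>Basis. u \<bullet> b))"
    have ub: "0 \<le> u \<bullet> b" using u b by (auto simp: nonneg_orthant_def)
    have P: "0 \<le> ?P" using moment_nonneg[OF u bs] .
    have "\<bar>exp ((x + t *\<^sub>R b) \<bullet> u) - exp (x \<bullet> u)\<bar> \<le> \<bar>(x + t *\<^sub>R b) \<bullet> u - x \<bullet> u\<bar> * ?E"
      using t \<delta> by (intro abs_exp_diff_le inner_le_neg_sum u) (auto simp: S_def)
    also have "\<dots> = \<bar>t\<bar> * (u \<bullet> b) * ?E"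
      using ub by (simp add: inner_add_left abs_mult inner_commute[of b u])
    finally have "?P * \<bar>exp ((x + t *\<^sub>R b) \<bullet> u) - exp (x \<bullet> u)\<bar> \<le> ?P * (\<bar>t\<bar> * (u \<bullet> b) * ?E)"
      using P by (rule mult_left_mono)
    also have "\<dots> = \<bar>t\<bar> * ((\<Prod>b\<leftarrow>b # bs. u \<bullet> b) * ?E)"
      by simp
    also have "\<dots> \<le> \<bar>t\<bar> * C"
      using C(2)[OF u] by (intro mult_left_mono) auto
    finally have "?P * \<bar>exp ((x + t *\<^sub>R b) \<bullet> u) - exp (x \<bullet> u)\<bar> \<le> \<bar>t\<bar> * C" .
    moreover
    have "q t u = ?P * (exp ((x + t *\<^sub>R b) \<bullet> u) - exp (x \<bullet> u)) / t"
      by (simp add: q_def kernel_def right_diff_distrib)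
    then have "\<bar>q t u\<bar> = ?P * \<bar>exp ((x + t *\<^sub>R b) \<bullet> u) - exp (x \<bullet> u)\<bar> / \<bar>t\<bar>"
      using P by (simp add: abs_mult)
    ultimately show ?thesis
      using t by (simp add: pos_divide_le_eq mult.commute)
  qed
  have q_lim: "((\<lambda>t. q t u) \<longlongrightarrow> kernel (b # bs) x u) (at 0 within S)" for u
  proof -
    have "((\<lambda>t. p * exp (a + t * c) - k) has_field_derivative c * p * exp a) (at 0)" for p a c k :: real
      by (rule derivative_eq_intros refl | simp)+
    from this[of "\<Prod>b\<leftarrow>bs. u \<bullet> b" "x \<bullet> u" "b \<bullet> u"]
    have "((\<lambda>t. kernel bs (x + t *\<^sub>R b) u) has_field_derivative kernel (b # bs) x u) (at 0)"
      by (simp add: kernel_def inner_add_left inner_commute[of b u])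
    then show ?thesis
      using at_within_open[OF S(2,1)] by (simp add: has_field_derivative_iff q_def)
  qed
  have "((\<lambda>t. \<integral>u. q t u \<partial>N) \<longlongrightarrow> (\<integral>u. kernel (b # bs) x u \<partial>N)) (at 0 within S)"
  proof (rule tendsto_integral_within)
    show "q t \<in> borel_measurable N" for t
      unfolding q_def using measurable_kernel by measurable
    show "AE u in N. \<forall>t\<in>S - {0}. \<bar>q t u\<bar> \<le> C"
      using concentrated by eventually_elim (use q_le in auto)
  qed (use q_lim in \<open>auto intro: measurable_kernel\<close>)
  moreover have "(\<integral>u. q t u \<partial>N) =
      ((\<integral>u. kernel bs (x + t *\<^sub>R b) u \<partial>N) - (\<integral>u. kernel bs x u \<partial>N)) / t" if "t \<in> S" for t
  proof -
    have "x + t *\<^sub>R b \<in> neg_orthant"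
      using that \<delta>(1) by (force simp: S_def neg_orthant_def)
    then show ?thesis
      unfolding q_def using bs x by (simp add: integrable_kernel)
  qed
  moreover have "\<forall>\<^sub>F t in at 0 within S. t \<in> S"
    by (simp add: eventually_at_filter)
  ultimately have "((\<lambda>t. ((\<integral>u. kernel bs (x + t *\<^sub>R b) u \<partial>N) - (\<integral>u. kernel bs x u \<partial>N)) / t)
      \<longlongrightarrow> (\<integral>u. kernel (b # bs) x u \<partial>N)) (at 0 within S)"
    by (auto elim!: Lim_transform_eventually eventually_mono)
  then show ?thesis
    using at_within_open[OF S(2,1)] by (simp add: has_field_derivative_iff)
qed

text \<open>Values outside the negative orthant do not influence derivatives at its points, since it is
  open.\<close>

lemma has_partial_derivative_if_eq_integral_kernel:
  assumes bs: "set bs \<subseteq> Basis" and b: "b \<in> Basis" and x: "x \<in> neg_orthant"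
    and f: "\<And>x. x \<in> neg_orthant \<Longrightarrow> f x = (\<integral>u. kernel bs x u \<partial>N)"
  shows "((\<lambda>t. f (x + t *\<^sub>R b)) has_field_derivative (\<integral>u. kernel (b # bs) x u \<partial>N)) (at 0)"
proof -
  have "open ((\<lambda>t. x + t *\<^sub>R b) -` neg_orthant)"
    unfolding neg_orthant_def by (intro open_vimage open_shifted_orthant continuous_intros)
  then have "\<forall>\<^sub>F t in nhds 0. x + t *\<^sub>R b \<in> neg_orthant"
    using x eventually_nhds_in_open[of "(\<lambda>t. x + t *\<^sub>R b) -` neg_orthant" 0] by simp
  then have "\<forall>\<^sub>F t in nhds 0. f (x + t *\<^sub>R b) = (\<integral>u. kernel bs (x + t *\<^sub>R b) u \<partial>N)"
    by eventually_elim (rule f)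
  from DERIV_cong_ev[OF refl this refl] show ?thesis
    using has_partial_derivative_integral_kernel[OF bs b x] by simp
qed

lemma iterated_partial_eq:
  assumes "\<And>x. x \<in> neg_orthant \<Longrightarrow> f x = (\<integral>u. (exp (x \<bullet> u) - 1) \<partial>N)"
    and "set bs \<subseteq> Basis" "x \<in> neg_orthant"
  shows "iterated_partial bs f x = (\<integral>u. kernel bs x u \<partial>N)"
  using assms(2,3)
proof (induction bs arbitrary: x)
  case Nil
  then show ?case
    by (simp add: iterated_partial_def kernel_def assms(1))
next
  case (Cons b bs)
  have "((\<lambda>t. iterated_partial bs f (x + t *\<^sub>R b)) has_field_derivative
      (\<integral>u. kernel (b # bs) x u \<partial>N)) (at 0)"
    using Cons by (intro has_partial_derivative_if_eq_integral_kernel) auto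
  then show ?case
    by (simp add: iterated_partial_def partial_derivative_def DERIV_imp_deriv)
qed

lemma C_infinity_on_neg_orthant:
  assumes f: "\<And>x. x \<in> neg_orthant \<Longrightarrow> f x = (\<integral>u. (exp (x \<bullet> u) - 1) \<partial>N)"
  shows "C_infinity_on neg_orthant f"
  unfolding C_infinity_on_def
proof (intro allI impI conjI ballI)
  fix bs :: "'a list" assume bs: "set bs \<subseteq> Basis"
  have eq: "iterated_partial bs f x = (\<integral>u. kernel bs x u \<partial>N)" if "x \<in> neg_orthant" for x
    using iterated_partial_eq[of f, OF f bs that] .
  then show "continuous_on neg_orthant (iterated_partial bs f)"
    by (intro continuous_on_eq[OF continuous_on_integral_kernel[OF bs]]) simp
  show "(\<lambda>t. iterated_partial bs f (x + t *\<^sub>R b)) field_differentiable at 0"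
    if "x \<in> neg_orthant" "b \<in> Basis" for x b
    unfolding field_differentiable_def
    using has_partial_derivative_if_eq_integral_kernel[OF bs that(2,1), of "iterated_partial bs f"] eq
    by blast
qed

text \<open>After at least one differentiation the constant \<open>1\<close> is gone and the kernel is a product
  of nonnegative coordinates with an exponential; before it, the integrand is nonpositive because
  \<open>x \<bullet> u \<le> 0\<close>.\<close>

lemma class_T_if_integral:
  assumes f: "\<And>x. x \<in> neg_orthant \<Longrightarrow> f x = (\<integral>u. (exp (x \<bullet> u) - 1) \<partial>N)"
  shows "f \<in> class_T"
proof -
  have smooth: "C_infinity_on neg_orthant f"
    by (rule C_infinity_on_neg_orthant[OF f])
  have partial: "iterated_partial bs (partial_derivative b f) = iterated_partial (bs @ [b]) f" for bs b
    by (simp add: iterated_partial_def)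
  have "f x \<le> 0" if x: "x \<in> neg_orthant" for x
  proof -
    obtain \<delta> where \<delta>: "0 < \<delta>" "x \<in> {x. \<forall>b\<in>Basis. x \<bullet> b < - \<delta>}"
      using neg_orthant_shift[OF x] .
    have "x \<bullet> u \<le> 0" if u: "u \<in> nonneg_orthant" for u
    proof -
      have "0 \<le> \<delta> * (\<Sum>b\<in>Basis. u \<bullet> b)"
        using \<delta> u by (intro mult_nonneg_nonneg sum_nonneg) (auto simp: nonneg_orthant_def)
      then show ?thesis
        using inner_le_neg_sum[OF u, of x \<delta>] \<delta> by auto
    qed
    then have "AE u in N. exp (x \<bullet> u) - 1 \<le> 0"
      using concentrated by (auto elim: eventually_mono)
    then have "0 \<le> (\<integral>u. - (exp (x \<bullet> u) - 1) \<partial>N)"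
      by (intro integral_nonneg_AE) (auto elim: eventually_mono)
    then show ?thesis
      unfolding f[OF x] Bochner_Integration.integral_minus by linarith
  qed
  moreover have "absolutely_monotone (partial_derivative b f)" if b: "b \<in> Basis" for b
    unfolding absolutely_monotone_def
  proof (intro conjI allI impI ballI)
    show "C_infinity_on neg_orthant (partial_derivative b f)"
      unfolding C_infinity_on_def partial
    proof (intro allI impI)
      fix bs :: "'a list" assume "set bs \<subseteq> Basis"
      then have "set (bs @ [b]) \<subseteq> Basis" using b by simp
      with smooth show "continuous_on neg_orthant (iterated_partial (bs @ [b]) f) \<and>
          (\<forall>x\<in>neg_orthant. \<forall>c\<in>Basis.
            (\<lambda>t. iterated_partial (bs @ [b]) f (x + t *\<^sub>R c)) field_differentiable at 0)"
        unfolding C_infinity_on_def by blast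
    qed
  next
    fix bs :: "'a list" and x :: 'a assume bs: "set bs \<subseteq> Basis" and x: "x \<in> neg_orthant"
    have bs': "set (bs @ [b]) \<subseteq> Basis" using bs b by simp
    have "0 \<le> (\<integral>u. kernel (bs @ [b]) x u \<partial>N)"
    proof (rule integral_nonneg_AE)
      show "AE u in N. 0 \<le> kernel (bs @ [b]) x u"
        using concentrated
      proof eventually_elim
        case (elim u)
        show ?case using moment_nonneg[OF elim bs'] by (simp add: kernel_def)
      qed
    qed
    then show "0 \<le> iterated_partial bs (partial_derivative b f) x"
      using iterated_partial_eq[of f, OF f bs' x] by (simp add: partial)
  qed
  ultimately show ?thesis
    using smooth by (simp add: class_T_def)
qed

end


section \<open>The image measure on the quadrant\<close>

text \<open>Carrying the restriction in the measure turns the integrals over the quadrant into plain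
  integrals with respect to a finite measure on the plane.\<close>

definition quadrant_measure :: "real measure \<Rightarrow> (real \<times> real) measure" where
  "quadrant_measure \<mu>\<^sub>1 =
     density (scale_measure (1/2) (image_measure \<mu>\<^sub>1)) (\<lambda>u. ennreal (indicator ({0<..} \<times> {0<..}) u))"

lemma quadrant_measurable [measurable]: "{0<..} \<times> {0<..} \<in> sets (borel :: (real \<times> real) measure)"
  by (intro borel_open open_Times) auto

lemma sets_quadrant_measure [simp, measurable_cong]: "sets (quadrant_measure \<mu>\<^sub>1) = sets borel"
  by (simp add: quadrant_measure_def image_measure_def)

lemma
  fixes f :: "real \<times> real \<Rightarrow> real"
  assumes [measurable]: "f \<in> borel_measurable borel"
  shows set_integrable_iff_quadrant_measure:
      "set_integrable (scale_measure (1/2) (image_measure \<mu>\<^sub>1)) ({0<..} \<times> {0<..}) f \<longleftrightarrow>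
        integrable (quadrant_measure \<mu>\<^sub>1) f"
    and set_integral_eq_quadrant_measure:
      "set_lebesgue_integral (scale_measure (1/2) (image_measure \<mu>\<^sub>1)) ({0<..} \<times> {0<..}) f =
        (\<integral>u. f u \<partial>quadrant_measure \<mu>\<^sub>1)"
proof -
  have [measurable_cong]: "sets (scale_measure (1/2) (image_measure \<mu>\<^sub>1)) = sets borel"
    by (simp add: image_measure_def)
  have 1: "f \<in> borel_measurable (scale_measure (1/2) (image_measure \<mu>\<^sub>1))"
    and 2: "(indicator ({0<..} \<times> {0<..}) :: _ \<Rightarrow> real) \<in> borel_measurable (scale_measure (1/2) (image_measure \<mu>\<^sub>1))"
    by measurable
  show "set_integrable (scale_measure (1/2) (image_measure \<mu>\<^sub>1)) ({0<..} \<times> {0<..}) f \<longleftrightarrow>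
      integrable (quadrant_measure \<mu>\<^sub>1) f"
    unfolding quadrant_measure_def set_integrable_def by (subst integrable_density[OF 1 2]) auto
  show "set_lebesgue_integral (scale_measure (1/2) (image_measure \<mu>\<^sub>1)) ({0<..} \<times> {0<..}) f =
      (\<integral>u. f u \<partial>quadrant_measure \<mu>\<^sub>1)"
    unfolding quadrant_measure_def set_lebesgue_integral_def by (subst integral_density[OF 1 2]) auto
qed

lemma AE_quadrant_measure: "AE u in quadrant_measure \<mu>\<^sub>1. u \<in> {0<..} \<times> {0<..}"
proof -
  have [measurable_cong]: "sets (scale_measure (1/2) (image_measure \<mu>\<^sub>1)) = sets borel"
    by (simp add: image_measure_def)
  show ?thesis
    unfolding quadrant_measure_def by (subst AE_density) (auto split: split_indicator)
qed

text \<open>Tonelli's theorem with \<open>w\<close> as the inner variable: the point \<open>((v + w) / 2, (v - w) / 2)\<close> lies in the open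
  quadrant iff \<open>\<bar>w\<bar> < v\<close>.\<close>

lemma nn_integral_quadrant_measure:
  assumes sets: "sets \<mu>\<^sub>1 = sets (restrict_space borel {0<..})"
    and g [measurable]: "g \<in> borel_measurable borel"
  shows "(\<integral>\<^sup>+u. g u \<partial>quadrant_measure \<mu>\<^sub>1) =
    (\<integral>\<^sup>+v. (1/2 * \<integral>\<^sup>+w. g ((v + w) / 2, (v - w) / 2) * indicator {- v<..<v} w \<partial>lborel) \<partial>\<mu>\<^sub>1)"
proof -
  have id [measurable]: "(\<lambda>v. v) \<in> borel_measurable \<mu>\<^sub>1"
    using measurable_restrict_space1[of "\<lambda>v. v" borel borel] measurable_cong_sets[OF sets refl] by auto
  have [measurable]: "fst \<in> borel_measurable (\<mu>\<^sub>1 \<Otimes>\<^sub>M lborel)"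
    using measurable_compose[OF measurable_fst id] by simp
  have [measurable]: "(\<lambda>(v, w). ((v + w) / 2, (v - w) / 2 :: real)) \<in> borel_measurable (\<mu>\<^sub>1 \<Otimes>\<^sub>M lborel)"
    unfolding case_prod_beta by measurable
  let ?Q = "{0<..} \<times> {0<..} :: (real \<times> real) set"
  define h where "h u = ennreal (indicator ?Q u) * g u" for u
  have h [measurable]: "h \<in> borel_measurable borel"
    unfolding h_def by measurable
  have [measurable_cong]: "sets (image_measure \<mu>\<^sub>1) = sets borel"
    by (simp add: image_measure_def)
  have inner: "(\<lambda>v. \<integral>\<^sup>+w. h ((v + w) / 2, (v - w) / 2) \<partial>lborel) \<in> borel_measurable \<mu>\<^sub>1"
    using lborel.borel_measurable_nn_integral_fst[of "\<lambda>p. h ((fst p + snd p) / 2, (fst p - snd p) / 2)" \<mu>\<^sub>1]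
    by simp
  have "(\<integral>\<^sup>+u. g u \<partial>quadrant_measure \<mu>\<^sub>1) = (\<integral>\<^sup>+u. h u \<partial>scale_measure (1/2) (image_measure \<mu>\<^sub>1))"
    unfolding quadrant_measure_def h_def by (subst nn_integral_density) auto
  also have "\<dots> = 1/2 * (\<integral>\<^sup>+u. h u \<partial>image_measure \<mu>\<^sub>1)"
    by (subst nn_integral_scale_measure) auto
  also have "(\<integral>\<^sup>+u. h u \<partial>image_measure \<mu>\<^sub>1) = (\<integral>\<^sup>+p. h ((fst p + snd p) / 2, (fst p - snd p) / 2) \<partial>(\<mu>\<^sub>1 \<Otimes>\<^sub>M lborel))"
    unfolding image_measure_def by (subst nn_integral_distr) (auto simp: case_prod_beta)
  also have "\<dots> = (\<integral>\<^sup>+v. \<integral>\<^sup>+w. h ((v + w) / 2, (v - w) / 2) \<partial>lborel \<partial>\<mu>\<^sub>1)"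
    by (subst lborel.nn_integral_fst[symmetric]) auto
  also have "1/2 * \<dots> = (\<integral>\<^sup>+v. (1/2 * \<integral>\<^sup>+w. h ((v + w) / 2, (v - w) / 2) \<partial>lborel) \<partial>\<mu>\<^sub>1)"
    by (rule nn_integral_cmult[symmetric, OF inner])
  also have "\<dots> = (\<integral>\<^sup>+v. (1/2 * \<integral>\<^sup>+w. g ((v + w) / 2, (v - w) / 2) * indicator {- v<..<v} w \<partial>lborel) \<partial>\<mu>\<^sub>1)"
    by (intro nn_integral_cong arg_cong2[where f="(*)"] refl)
       (auto simp: h_def split: split_indicator)
  finally show ?thesis .
qed

lemma half_mult_ennreal: "1/2 * ennreal (2 * d) = ennreal d"
proof -
  have "(1/2 :: ennreal) = ennreal (1/2)"
    using divide_ennreal[of 1 2] by simp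
  then have "1/2 * ennreal (2 * d) = ennreal (1/2 * (2 * d))"
    by (simp only: ennreal_mult' zero_le_divide_1_iff zero_le_numeral)
  then show ?thesis
    by simp
qed

lemma emeasure_quadrant_measure:
  assumes sets: "sets \<mu>\<^sub>1 = sets (restrict_space borel {0<..})"
  shows "emeasure (quadrant_measure \<mu>\<^sub>1) (space (quadrant_measure \<mu>\<^sub>1)) = (\<integral>\<^sup>+v. ennreal v \<partial>\<mu>\<^sub>1)"
proof -
  have space: "space \<mu>\<^sub>1 = {0<..}"
    using sets_eq_imp_space_eq[OF sets] by (simp add: space_restrict_space)
  have "emeasure (quadrant_measure \<mu>\<^sub>1) (space (quadrant_measure \<mu>\<^sub>1)) = (\<integral>\<^sup>+u. 1 \<partial>quadrant_measure \<mu>\<^sub>1)"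
    by simp
  also have "\<dots> = (\<integral>\<^sup>+v. ennreal v \<partial>\<mu>\<^sub>1)"
    unfolding nn_integral_quadrant_measure[OF sets borel_measurable_const]
  proof (rule nn_integral_cong)
    fix v assume "v \<in> space \<mu>\<^sub>1"
    then have v: "0 < v" by (simp add: space)
    then have "(\<integral>\<^sup>+w. 1 * indicator {- v<..<v} w \<partial>lborel) = ennreal (2 * v)"
      by simp
    then show "1/2 * (\<integral>\<^sup>+w. 1 * indicator {- v<..<v} w \<partial>lborel) = ennreal v"
      by (simp only: half_mult_ennreal)
  qed
  finally show ?thesis .
qed

text \<open>The exponent is \<open>((s\<^sub>1 + s\<^sub>2) v + (s\<^sub>1 - s\<^sub>2) w) / 2\<close>, so an antiderivative in \<open>w\<close> is the
  exponential times \<open>2 / (s\<^sub>1 - s\<^sub>2)\<close>; the factor \<open>2\<close> cancels the scaling by \<open>1/2\<close>, and the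
  endpoints \<open>w = \<plusminus>v\<close> give \<open>exp (s\<^sub>1 v)\<close> and \<open>exp (s\<^sub>2 v)\<close>.\<close>

lemma nn_integral_exp_quadrant_measure:
  assumes sets: "sets \<mu>\<^sub>1 = sets (restrict_space borel {0<..})"
    and s: "s\<^sub>1 \<noteq> s\<^sub>2"
  shows "(\<integral>\<^sup>+u. ennreal (exp ((s\<^sub>1, s\<^sub>2) \<bullet> u)) \<partial>quadrant_measure \<mu>\<^sub>1) =
    (\<integral>\<^sup>+v. ennreal ((exp (s\<^sub>1 * v) - exp (s\<^sub>2 * v)) / (s\<^sub>1 - s\<^sub>2)) \<partial>\<mu>\<^sub>1)"
proof -
  have space: "space \<mu>\<^sub>1 = {0<..}"
    using sets_eq_imp_space_eq[OF sets] by (simp add: space_restrict_space)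
  have meas: "(\<lambda>u. ennreal (exp ((s\<^sub>1, s\<^sub>2) \<bullet> u))) \<in> borel_measurable borel"
    by measurable
  show ?thesis
    unfolding nn_integral_quadrant_measure[OF sets meas]
  proof (rule nn_integral_cong)
    fix v assume "v \<in> space \<mu>\<^sub>1"
    then have v: "0 < v" by (simp add: space)
    let ?e = "\<lambda>w. exp ((s\<^sub>1, s\<^sub>2) \<bullet> ((v + w) / 2, (v - w) / 2))"
    let ?d = "(exp (s\<^sub>1 * v) - exp (s\<^sub>2 * v)) / (s\<^sub>1 - s\<^sub>2)"
    have "(\<integral>\<^sup>+w. ennreal (?e w) * indicator {- v<..<v} w \<partial>lborel) =
        (\<integral>\<^sup>+w. ennreal (?e w) * indicator {- v..v} w \<partial>lborel)"
    proof (rule nn_integral_cong_AE)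
      have "AE w in lborel. w \<noteq> v" "AE w in lborel. w \<noteq> - v"
        by (rule AE_lborel_singleton)+
      then show "AE w in lborel. ennreal (?e w) * indicator {- v<..<v} w = ennreal (?e w) * indicator {- v..v} w"
        by eventually_elim (auto split: split_indicator)
    qed
    also have "\<dots> = ennreal (2 / (s\<^sub>1 - s\<^sub>2) * ?e v - 2 / (s\<^sub>1 - s\<^sub>2) * ?e (- v))"
    proof (rule nn_integral_FTC_Icc[where F="\<lambda>w. 2 / (s\<^sub>1 - s\<^sub>2) * ?e w"])
      fix w
      have "((\<lambda>w. (s\<^sub>1, s\<^sub>2) \<bullet> ((v + w) / 2, (v - w) / 2)) has_field_derivative (s\<^sub>1 - s\<^sub>2) / 2) (at w)"
        unfolding inner_Pair inner_real_def
        by (rule derivative_eq_intros refl | simp add: field_simps)+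
      from DERIV_cmult[OF DERIV_fun_exp[OF this], of "2 / (s\<^sub>1 - s\<^sub>2)"]
      show "((\<lambda>w. 2 / (s\<^sub>1 - s\<^sub>2) * ?e w) has_field_derivative ?e w) (at w)"
        using s by simp
    qed (use v in auto)
    also have "2 / (s\<^sub>1 - s\<^sub>2) * ?e v - 2 / (s\<^sub>1 - s\<^sub>2) * ?e (- v) = 2 * ?d"
      by (simp add: diff_divide_distrib right_diff_distrib)
    finally show "1/2 * (\<integral>\<^sup>+w. ennreal (?e w) * indicator {- v<..<v} w \<partial>lborel) = ennreal ?d"
      by (simp only: half_mult_ennreal)
  qed
qed

lemma orthant_measure_quadrant_measure:
  assumes sets: "sets \<mu>\<^sub>1 = sets (restrict_space borel {0<..})"
    and fin: "(\<integral>\<^sup>+v. ennreal v \<partial>\<mu>\<^sub>1) \<noteq> \<infinity>"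
  shows "orthant_measure (quadrant_measure \<mu>\<^sub>1)"
proof (intro orthant_measure.intro finite_measureI orthant_measure_axioms.intro)
  show "emeasure (quadrant_measure \<mu>\<^sub>1) (space (quadrant_measure \<mu>\<^sub>1)) \<noteq> \<infinity>"
    using fin emeasure_quadrant_measure[OF sets] by simp
  show "AE u in quadrant_measure \<mu>\<^sub>1. u \<in> nonneg_orthant"
    using AE_quadrant_measure by (rule eventually_mono) (auto simp: nonneg_orthant_def Basis_prod_def)
qed simp

section \<open>The divided difference\<close>

theorem mainTheorem5:
  fixes \<psi>\<^sub>1 :: "real \<Rightarrow> real" and \<mu>\<^sub>1 :: "real measure" and c\<^sub>0 :: real and \<omega> :: ennreal
  assumes "\<psi>\<^sub>1 \<in> class_T"
    and "radon_measure_on {0<..} \<mu>\<^sub>1"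
    and "(\<psi>\<^sub>1 \<longlongrightarrow> c\<^sub>0) (at_left 0)" and "c\<^sub>0 \<le> 0"
    and "\<And>s. s < 0 \<Longrightarrow> integrable \<mu>\<^sub>1 (\<lambda>u. exp (s * u) - 1)"
    and "\<And>s. s < 0 \<Longrightarrow> \<psi>\<^sub>1 s = c\<^sub>0 + (\<integral>u. (exp (s * u) - 1) \<partial>\<mu>\<^sub>1)"
    and "\<omega> = (\<integral>\<^sup>+u. ennreal u \<partial>\<mu>\<^sub>1)" and "\<omega> \<noteq> \<infinity>"
  shows "psi_of \<psi>\<^sub>1 (enn2real \<omega>) \<in> class_T \<and>
    (\<forall>s\<^sub>1<0. \<forall>s\<^sub>2<0.
      set_integrable (scale_measure (1/2) (image_measure \<mu>\<^sub>1)) ({0<..} \<times> {0<..})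
        (\<lambda>(u\<^sub>1, u\<^sub>2). exp (s\<^sub>1 * u\<^sub>1 + s\<^sub>2 * u\<^sub>2) - 1) \<and>
      psi_of \<psi>\<^sub>1 (enn2real \<omega>) (s\<^sub>1, s\<^sub>2) =
        set_lebesgue_integral (scale_measure (1/2) (image_measure \<mu>\<^sub>1)) ({0<..} \<times> {0<..})
          (\<lambda>(u\<^sub>1, u\<^sub>2). exp (s\<^sub>1 * u\<^sub>1 + s\<^sub>2 * u\<^sub>2) - 1))"
proof -
  have sets: "sets \<mu>\<^sub>1 = sets (restrict_space borel {0<..})"
    using assms(2) by (simp add: radon_measure_on_def)
  have space: "space \<mu>\<^sub>1 = {0<..}"
    using sets_eq_imp_space_eq[OF sets] by (simp add: space_restrict_space)
  define N where "N = quadrant_measure \<mu>\<^sub>1"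
  interpret orthant_measure N
    unfolding N_def using orthant_measure_quadrant_measure[OF sets] assms(7,8) by simp
  have mass: "measure N (space N) = enn2real \<omega>"
    by (simp add: N_def measure_def emeasure_quadrant_measure[OF sets] assms(7))
  have neg: "(s\<^sub>1, s\<^sub>2) \<in> neg_orthant \<longleftrightarrow> s\<^sub>1 < 0 \<and> s\<^sub>2 < 0" for s\<^sub>1 s\<^sub>2 :: real
    by (auto simp: neg_orthant_def Basis_prod_def)
  define F where "F s = (\<integral>u. (exp (s \<bullet> u) - 1) \<partial>N)" for s :: "real \<times> real"
  have integrable: "integrable N (\<lambda>u. exp (s \<bullet> u) - 1)" if "s \<in> neg_orthant" for s
    using integrable_kernel[of "[]", OF _ that] by (simp add: kernel_def[abs_def])

  \<comment> \<open>Positive integrands on both sides, so the equality of their \<open>nn_integral\<close>s carries over.\<close>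
  have off_diagonal: "shifted_quotient \<psi>\<^sub>1 (enn2real \<omega>) s\<^sub>1 s\<^sub>2 = F (s\<^sub>1, s\<^sub>2)"
    if s: "s\<^sub>1 < 0" "s\<^sub>2 < 0" "s\<^sub>1 \<noteq> s\<^sub>2" for s\<^sub>1 s\<^sub>2
  proof -
    have int: "integrable \<mu>\<^sub>1 (\<lambda>v. (exp (s\<^sub>1 * v) - exp (s\<^sub>2 * v)) / (s\<^sub>1 - s\<^sub>2))"
      using Bochner_Integration.integrable_diff[OF assms(5)[OF s(1)] assms(5)[OF s(2)]] by simp
    have "\<psi>\<^sub>1 s\<^sub>1 - \<psi>\<^sub>1 s\<^sub>2 = (\<integral>v. (exp (s\<^sub>1 * v) - exp (s\<^sub>2 * v)) \<partial>\<mu>\<^sub>1)"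
      using Bochner_Integration.integral_diff[OF assms(5)[OF s(1)] assms(5)[OF s(2)]]
      by (simp add: assms(6) s)
    then have "(\<psi>\<^sub>1 s\<^sub>1 - \<psi>\<^sub>1 s\<^sub>2) / (s\<^sub>1 - s\<^sub>2) = (\<integral>v. (exp (s\<^sub>1 * v) - exp (s\<^sub>2 * v)) / (s\<^sub>1 - s\<^sub>2) \<partial>\<mu>\<^sub>1)"
      by simp
    also have "\<dots> = enn2real (\<integral>\<^sup>+v. ennreal ((exp (s\<^sub>1 * v) - exp (s\<^sub>2 * v)) / (s\<^sub>1 - s\<^sub>2)) \<partial>\<mu>\<^sub>1)"
    proof (rule integral_eq_nn_integral)
      show "AE v in \<mu>\<^sub>1. 0 \<le> (exp (s\<^sub>1 * v) - exp (s\<^sub>2 * v)) / (s\<^sub>1 - s\<^sub>2)"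
      proof (rule AE_I2)
        fix v assume "v \<in> space \<mu>\<^sub>1"
        then show "0 \<le> (exp (s\<^sub>1 * v) - exp (s\<^sub>2 * v)) / (s\<^sub>1 - s\<^sub>2)"
          using s by (cases "s\<^sub>1 < s\<^sub>2") (auto simp: space divide_simps)
      qed
    qed (use int in auto)
    also have "\<dots> = enn2real (\<integral>\<^sup>+u. ennreal (exp ((s\<^sub>1, s\<^sub>2) \<bullet> u)) \<partial>N)"
      by (simp add: N_def nn_integral_exp_quadrant_measure[OF sets s(3)])
    also have "\<dots> = (\<integral>u. exp ((s\<^sub>1, s\<^sub>2) \<bullet> u) \<partial>N)"
      by (rule integral_eq_nn_integral[symmetric]) (auto simp: N_def)
    also have "\<dots> = (\<integral>u. (exp ((s\<^sub>1, s\<^sub>2) \<bullet> u) - 1) + 1 \<partial>N)"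
      by simp
    also have "\<dots> = F (s\<^sub>1, s\<^sub>2) + enn2real \<omega>"
      unfolding F_def using integrable[of "(s\<^sub>1, s\<^sub>2)"] s
      by (subst Bochner_Integration.integral_add) (auto simp: neg mass)
    finally show ?thesis by (simp add: shifted_quotient_def)
  qed

  \<comment> \<open>The limit defining the diagonal value is computed from the continuity of the transform,
    without differentiating \<open>\<psi>\<^sub>1\<close>.\<close>
  have diagonal: "Lim (at s) (shifted_quotient \<psi>\<^sub>1 (enn2real \<omega>) s) = F (s, s)" if s: "s < 0" for s
  proof (rule tendsto_Lim)
    have "continuous_on neg_orthant F"
      using continuous_on_integral_kernel[of "[]"] by (simp add: kernel_def F_def[abs_def])
    moreover have "open (neg_orthant :: (real \<times> real) set)"
      unfolding neg_orthant_def by (rule open_shifted_orthant)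
    ultimately have "isCont F (s, s)"
      using s by (simp add: continuous_on_eq_continuous_at neg)
    then have "((\<lambda>t. F (s, t)) \<longlongrightarrow> F (s, s)) (at s)"
      by (rule isCont_tendsto_compose) (intro tendsto_intros)
    moreover have "\<forall>\<^sub>F t in at s. F (s, t) = shifted_quotient \<psi>\<^sub>1 (enn2real \<omega>) s t"
      using eventually_at_in_open[of "{..<0}" s] s
      by (auto elim!: eventually_mono simp: off_diagonal)
    ultimately show "(shifted_quotient \<psi>\<^sub>1 (enn2real \<omega>) s \<longlongrightarrow> F (s, s)) (at s)"
      by (rule Lim_transform_eventually)
  qed simp

  have psi: "psi_of \<psi>\<^sub>1 (enn2real \<omega>) s = F s" if "s \<in> neg_orthant" for s
    using that by (cases s) (auto simp: psi_of_def neg diagonal off_diagonal)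
  have kernel_eq: "(\<lambda>(u\<^sub>1, u\<^sub>2). exp (s\<^sub>1 * u\<^sub>1 + s\<^sub>2 * u\<^sub>2) - 1) = (\<lambda>u. exp ((s\<^sub>1, s\<^sub>2) \<bullet> u) - 1)"
    for s\<^sub>1 s\<^sub>2 :: real
    by (auto simp: fun_eq_iff)
  have meas: "(\<lambda>u. exp (s \<bullet> u) - 1) \<in> borel_measurable borel" for s :: "real \<times> real"
    by measurable
  show ?thesis
  proof (intro conjI allI impI)
    show "psi_of \<psi>\<^sub>1 (enn2real \<omega>) \<in> class_T"
      by (rule class_T_if_integral) (simp add: psi F_def)
  next
    fix s\<^sub>1 s\<^sub>2 :: real assume s: "s\<^sub>1 < 0" "s\<^sub>2 < 0"
    show "set_integrable (scale_measure (1/2) (image_measure \<mu>\<^sub>1)) ({0<..} \<times> {0<..})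
        (\<lambda>(u\<^sub>1, u\<^sub>2). exp (s\<^sub>1 * u\<^sub>1 + s\<^sub>2 * u\<^sub>2) - 1)"
      unfolding kernel_eq set_integrable_iff_quadrant_measure[OF meas]
      using integrable[of "(s\<^sub>1, s\<^sub>2)"] s by (simp add: neg N_def)
    show "psi_of \<psi>\<^sub>1 (enn2real \<omega>) (s\<^sub>1, s\<^sub>2) =
        set_lebesgue_integral (scale_measure (1/2) (image_measure \<mu>\<^sub>1)) ({0<..} \<times> {0<..})
          (\<lambda>(u\<^sub>1, u\<^sub>2). exp (s\<^sub>1 * u\<^sub>1 + s\<^sub>2 * u\<^sub>2) - 1)"
      unfolding kernel_eq set_integral_eq_quadrant_measure[OF meas]
      using psi[of "(s\<^sub>1, s\<^sub>2)"] s by (simp add: neg N_def F_def)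
  qed
qed

end
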